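(* Let $u_1,u_2,u_3,u_4,\alpha,\beta$ be indeterminates, and define $g_k=k(u_3+u_4)+\alpha\beta$ for $k\ge0$ and $b_k=k(\beta-1+k)u_1u_2$ for $k\ge1$. Define $\mu_{n,k}$ by $\mu_{0,0}=1$, $\mu_{n,k}=0$ if $k\notin[0,n]$, and $\mu_{n,k}=\mu_{n-1,k-1}+g_k\mu_{n-1,k}+b_{k+1}\mu_{n-1,k+1}$ for $n\ge k\ge0$, $n\ge1$. Then for all $0\le k\le n$, \[ \mu_{n,k}=\sum_{G\in {\rm LD}_{n,k}}u_1^{{\rm pk}(G)-k}u_2^{{\rm val}(G)}u_3^{{\rm da}(G)}u_4^{{\rm dd}(G)}\alpha^{{\rm fp}(G)}\beta^{{\rm cyc}(G)}. \]
   Context: A Laguerre digraph on $[n]=\{1,\dots,n\}$ is a directed graph with vertex set $[n]$ (loops allowed) in which every vertex has in-degree $0$ or $1$ and out-degree $0$ or $1$; its connected components are directed cycles (including loops) and directed paths (including isolated vertices). ${\rm LD}_{n,k}$ is the set of Laguerre digraphs on $[n]$ with exactly $k$ path components. For $G\in{\rm LD}_{n,k}$, extend $G$ to a digraph on $[n]\cup\{0\}$ by adding an edge $0\to i$ for each vertex $i$ of in-degree $0$ and an edge $i\to 0$ for each vertex $i$ of out-degree $0$; then each $i\in[n]$ has a unique predecessor $p(i)\in[n]\cup\{0\}$ and successor $s(i)\in[n]\cup\{0\}$. Vertex $i$ is a peak if $p(i)<i>s(i)$, a valley if $p(i)>i<s(i)$, a double ascent if $p(i)<i<s(i)$, a double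 descent if $p(i)>i>s(i)$, a fixed point if $p(i)=i=s(i)$. ${\rm pk}(G),{\rm val}(G),{\rm da}(G),{\rm dd}(G),{\rm fp}(G)$ are the numbers of such vertices, and ${\rm cyc}(G)$ is the number of cycle components of $G$ (loops included). *)

theory Defs
  imports Main "Graph_Theory.Graph_Theory"
begin

text \<open>The vertex sets of the connected components of a digraph, i.e. of the components
  of its symmetric closure.\<close>

definition component_verts :: "'v pair_pre_digraph \<Rightarrow> 'v set set" where
  "component_verts G = pre_digraph.sccs_verts (with_proj (mk_symmetric (with_proj G)))"

text \<open>For a list \<open>[v1, ..., vm]\<close>, the arcs of the directed path through it are the pairs of
  consecutive entries; the directed cycle has the additional arc \<open>(vm, v1)\<close>.  Hence a single
  vertex without arc is a path, and a single vertex with a loop is a cycle.\<close>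

definition path_components :: "'v pair_pre_digraph \<Rightarrow> 'v set set" where
  "path_components G = {C \<in> component_verts G.
     \<exists>vs. vs \<noteq> [] \<and> distinct vs \<and> set vs = C \<and> parcs G \<inter> C \<times> C = set (zip vs (tl vs))}"

definition cycle_components :: "'v pair_pre_digraph \<Rightarrow> 'v set set" where
  "cycle_components G = {C \<in> component_verts G.
     \<exists>vs. vs \<noteq> [] \<and> distinct vs \<and> set vs = C \<and> parcs G \<inter> C \<times> C = set (zip vs (rotate1 vs))}"

definition laguerre_digraphs :: "nat \<Rightarrow> nat pair_pre_digraph set" where
  "laguerre_digraphs n = {G. pair_wf_digraph G \<and> pverts G = {1..n} \<and>
     (\<forall>i\<in>{1..n}. in_degree (with_proj G) i \<le> 1 \<and> out_degree (with_proj G) i \<le> 1)}"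

definition LD :: "nat \<Rightarrow> nat \<Rightarrow> nat pair_pre_digraph set" where
  "LD n k = {G \<in> laguerre_digraphs n. card (path_components G) = k}"

definition zero_extension :: "nat pair_pre_digraph \<Rightarrow> nat pair_pre_digraph" where
  "zero_extension G = \<lparr> pverts = insert 0 (pverts G),
     parcs = parcs G \<union> {(0, i) |i. i \<in> pverts G \<and> in_degree (with_proj G) i = 0}
                     \<union> {(i, 0) |i. i \<in> pverts G \<and> out_degree (with_proj G) i = 0} \<rparr>"

definition pre :: "nat pair_pre_digraph \<Rightarrow> nat \<Rightarrow> nat" where
  "pre G i = (THE j. (j, i) \<in> parcs (zero_extension G))"

definition suc :: "nat pair_pre_digraph \<Rightarrow> nat \<Rightarrow> nat" where
  "suc G i = (THE j. (i, j) \<in> parcs (zero_extension G))"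

definition pk :: "nat pair_pre_digraph \<Rightarrow> nat" where
  "pk G = card {i \<in> pverts G. pre G i < i \<and> i > suc G i}"

definition valley :: "nat pair_pre_digraph \<Rightarrow> nat" where
  "valley G = card {i \<in> pverts G. pre G i > i \<and> i < suc G i}"

definition da :: "nat pair_pre_digraph \<Rightarrow> nat" where
  "da G = card {i \<in> pverts G. pre G i < i \<and> i < suc G i}"

definition dd :: "nat pair_pre_digraph \<Rightarrow> nat" where
  "dd G = card {i \<in> pverts G. pre G i > i \<and> i > suc G i}"

definition fp :: "nat pair_pre_digraph \<Rightarrow> nat" where
  "fp G = card {i \<in> pverts G. pre G i = i \<and> i = suc G i}"

definition cyc :: "nat pair_pre_digraph \<Rightarrow> nat" where
  "cyc G = card (cycle_components G)"

text \<open>The triangular array with \<open>\<mu>(0,0) = 1\<close>, \<open>\<mu>(n,k) = 0\<close> for \<open>k \<notin> {0..n}\<close>, and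
  \<open>\<mu>(n,k) = \<mu>(n-1,k-1) + g k * \<mu>(n-1,k) + b (k+1) * \<mu>(n-1,k+1)\<close> for \<open>n \<ge> 1\<close>, \<open>0 \<le> k \<le> n\<close>.
  As \<open>k\<close> is a natural number, the entry \<open>\<mu>(n-1,-1) = 0\<close> appears as an explicit case.
  The value \<open>b 0\<close> is never used.\<close>

fun tri_array :: "(nat \<Rightarrow> 'a::comm_ring_1) \<Rightarrow> (nat \<Rightarrow> 'a) \<Rightarrow> nat \<Rightarrow> nat \<Rightarrow> 'a" where
  "tri_array g b 0 k = (if k = 0 then 1 else 0)"
| "tri_array g b (Suc n) k =
     (if k \<le> Suc n
      then (if k = 0 then 0 else tri_array g b n (k - 1))
           + g k * tri_array g b n k + b (k + 1) * tri_array g b n (k + 1)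
      else 0)"

definition g_coeff :: "'a::comm_ring_1 \<Rightarrow> 'a \<Rightarrow> 'a \<Rightarrow> 'a \<Rightarrow> nat \<Rightarrow> 'a" where
  "g_coeff u3 u4 \<alpha> \<beta> k = of_nat k * (u3 + u4) + \<alpha> * \<beta>"

definition b_coeff :: "'a::comm_ring_1 \<Rightarrow> 'a \<Rightarrow> 'a \<Rightarrow> nat \<Rightarrow> 'a" where
  "b_coeff u1 u2 \<beta> k = of_nat k * (\<beta> - 1 + of_nat k) * u1 * u2"

definition \<mu> :: "'a::comm_ring_1 \<Rightarrow> 'a \<Rightarrow> 'a \<Rightarrow> 'a \<Rightarrow> 'a \<Rightarrow> 'a \<Rightarrow> nat \<Rightarrow> nat \<Rightarrow> 'a" where
  "\<mu> u1 u2 u3 u4 \<alpha> \<beta> n k = tri_array (g_coeff u3 u4 \<alpha> \<beta>) (b_coeff u1 u2 \<beta>) n k"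

text \<open>The six indeterminates are represented by arbitrary elements of an arbitrary commutative
  ring: an identity of polynomials over the integers is the same as its validity under all such
  evaluations.  In the weight, the subtraction \<open>pk G - k\<close> does not truncate: for
  \<open>G \<in> LD n k\<close>, the largest vertex of each of the \<open>k\<close> path components is a peak (the added
  vertex \<open>0\<close> is smaller than all others), so \<open>k \<le> pk G\<close>.  The set \<open>LD n k\<close> is finite, so the
  sum over it is a genuine one.\<close>

lemma finite_LD: "finite (LD n k)"
proof -
  have "LD n k \<subseteq> (\<lambda>E. \<lparr> pverts = {1..n}, parcs = E \<rparr>) ` Pow ({1..n} \<times> {1..n})"
  proof
    fix G assume "G \<in> LD n k"
    then have wf: "pair_wf_digraph G" and V: "pverts G = {1..n}"
      by (auto simp: LD_def laguerre_digraphs_def)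
    have "parcs G \<subseteq> {1..n} \<times> {1..n}"
      using pair_wf_digraph.in_arcsD1[OF wf] pair_wf_digraph.in_arcsD2[OF wf] V by auto
    moreover have "G = \<lparr> pverts = {1..n}, parcs = parcs G \<rparr>"
      using V by (cases G) simp
    ultimately show "G \<in> (\<lambda>E. \<lparr> pverts = {1..n}, parcs = E \<rparr>) ` Pow ({1..n} \<times> {1..n})"
      by blast
  qed
  then show ?thesis
    by (rule finite_subset) simp
qed

end

theory Submission
  imports Defs
begin

text \<open>Delete the smallest vertex \<open>v\<close> of a Laguerre digraph.  Since a missing neighbour is replaced
  by \<open>0\<close>, which like \<open>v\<close> is smaller than all remaining vertices, the types of the remaining
  vertices do not change.  Conversely, \<open>v\<close> can be added to a digraph with \<open>k\<close> paths as an isolated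
  vertex (a peak, one more path), as a loop (weight \<open>\<alpha>\<beta>\<close>), at the start or at the end of one of
  the \<open>k\<close> paths (a double ascent or a double descent), or as a valley between the end of a path
  and the start of a path.  In the last case \<open>k\<close> of the \<open>k\<^sup>2\<close> choices close a path to a cycle, giving
  the weight \<open>k(\<beta> + k - 1)u\<^sub>1u\<^sub>2\<close>.  This is the recurrence of the array.  To avoid relabelling,
  the induction runs over all finite vertex sets.\<close>

section \<open>Cycles of partial injections\<close>

text \<open>The arc sets of digraphs on \<open>V\<close> with in-degree and out-degree at most one:
  the degree bounds become single-valuedness of the relation and of its converse.\<close>

definition partial_injections :: "'a set \<Rightarrow> 'a rel set" where
  "partial_injections V = {E. E \<subseteq> V \<times> V \<and> single_valued E \<and> single_valued (E\<inverse>)}"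

text \<open>For single-valued \<open>E\<close>, the vertices reachable from a vertex on a cycle are
  exactly those of the cycle. This form needs no lists and follows the insertion of an arc
  easily.\<close>

definition cycle_sets :: "'a rel \<Rightarrow> 'a set set" where
  "cycle_sets E = {E\<^sup>* `` {x} |x. (x, x) \<in> E\<^sup>+}"

lemma partial_injectionsD:
  assumes "E \<in> partial_injections V"
  shows "E \<subseteq> V \<times> V" "single_valued E" "single_valued (E\<inverse>)"
  using assms by (auto simp: partial_injections_def)

lemma finite_partial_injections: "finite V \<Longrightarrow> finite (partial_injections V)"
  by (rule finite_subset[of _ "Pow (V \<times> V)"]) (auto simp: partial_injections_def)

text \<open>Distinct arcs have distinct heads. The set \<open>V - Range E\<close> consists of the
  starts of the paths, so its cardinality serves as the number of paths throughout.\<close>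

lemma card_non_range:
  assumes "finite V" "E \<in> partial_injections V"
  shows "card (V - Range E) = card V - card E"
proof -
  have "inj_on snd E"
    using partial_injectionsD[OF assms(2)] by (auto simp: inj_on_def single_valued_def)
  moreover have "Range E \<subseteq> V" "finite (Range E)"
    using partial_injectionsD(1)[OF assms(2)] assms(1) by (auto intro: finite_subset)
  ultimately show ?thesis
    by (simp add: card_Diff_subset card_image Range_snd)
qed

lemma card_non_domain:
  assumes "finite V" "E \<in> partial_injections V"
  shows "card (V - Domain E) = card V - card E"
proof -
  have "inj_on fst E"
    using partial_injectionsD[OF assms(2)] by (auto simp: inj_on_def single_valued_def)
  moreover have "Domain E \<subseteq> V" "finite (Domain E)"
    using partial_injectionsD(1)[OF assms(2)] assms(1) by (auto intro: finite_subset)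
  ultimately show ?thesis
    by (simp add: card_Diff_subset card_image Domain_fst)
qed

text \<open>The closed walk at \<open>x\<close> has to leave \<open>x\<close> through its only
  outgoing arc.\<close>

lemma cyclic_step:
  assumes "single_valued E" "(x, x) \<in> E\<^sup>+" "(x, y) \<in> E"
  shows "(y, x) \<in> E\<^sup>*"
  using assms by (metis single_valuedD tranclD)

text \<open>By \<open>cyclic_step\<close>, every arc that leaves a vertex on a cycle can be undone
  by walking on around the cycle.\<close>

lemma cyclic_reach:
  assumes "single_valued E" "(x, x) \<in> E\<^sup>+" "(x, y) \<in> E\<^sup>*"
  shows "(y, y) \<in> E\<^sup>+ \<and> (y, x) \<in> E\<^sup>*"
  using assms(3)
proof (induction rule: rtrancl_induct)
  case base
  then show ?case using assms(2) by simp
next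
  case (step y z)
  then have "(z, y) \<in> E\<^sup>*" using cyclic_step[OF assms(1)] by blast
  then show ?case using step by (meson rtrancl_into_trancl1 rtrancl_trans rtrancl_trancl_trancl)
qed

text \<open>With at most one outgoing arc per vertex, of two vertices reachable from
  \<open>b\<close> one is reachable from the other; a vertex without outgoing arc reaches only
  itself.\<close>

lemma end_reachable_unique:
  assumes "single_valued E" "(b, a) \<in> E\<^sup>*" "(b, c) \<in> E\<^sup>*" "a \<notin> Domain E" "c \<notin> Domain E"
  shows "a = c"
  using single_valued_confluent[OF assms(1-3)] assms(4,5)
  by (metis DomainI converse_rtranclE)

text \<open>If the walk from \<open>b\<close> never ended, the successor map would be an injective
  self-map of a finite set, hence surjective, and \<open>b\<close> would have a predecessor.\<close>

lemma end_reachable_exists: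
  assumes "finite V" "E \<in> partial_injections V" "b \<in> V - Range E"
  shows "\<exists>a \<in> V - Domain E. (b, a) \<in> E\<^sup>*"
proof (rule ccontr)
  note E = partial_injectionsD[OF assms(2)]
  define R where "R = E\<^sup>* `` {b}"
  have RV: "R \<subseteq> V"
  proof
    fix x assume "x \<in> R"
    then have "(b, x) \<in> E\<^sup>*" by (simp add: R_def)
    then show "x \<in> V" by (cases rule: rtranclE) (use E(1) assms(3) in auto)
  qed
  assume "\<not> ?thesis"
  with RV have "\<forall>x\<in>R. \<exists>y. (x, y) \<in> E" by (auto simp: R_def)
  then obtain f where f: "\<And>x. x \<in> R \<Longrightarrow> (x, f x) \<in> E" by metis
  have "f ` R \<subseteq> R"
    using f by (auto simp: R_def intro: rtrancl_into_rtrancl)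
  moreover have "inj_on f R"
    using f E(3) by (metis inj_onI converse_iff single_valuedD)
  moreover have "finite R" using RV assms(1) by (rule finite_subset)
  ultimately have "f ` R = R" by (simp add: endo_inj_surj)
  moreover have "b \<in> R" by (simp add: R_def)
  ultimately obtain x where "x \<in> R" "f x = b" by (metis imageE)
  then show False using f assms(3) by blast
qed

text \<open>A cycle through the new arc must return from \<open>b\<close> to \<open>a\<close> inside
  \<open>E\<close>. So a cycle is created only if \<open>b\<close> reaches \<open>a\<close>, and
  then it is the reachability set of \<open>b\<close>. The third claim makes the cycle count rise by
  exactly one.\<close>

lemma cycle_sets_insert:
  assumes "single_valued E" "a \<notin> Domain E"
  shows "(b, a) \<notin> E\<^sup>* \<Longrightarrow> cycle_sets (insert (a, b) E) = cycle_sets E"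
    and "(b, a) \<in> E\<^sup>* \<Longrightarrow> cycle_sets (insert (a, b) E) = insert (E\<^sup>* `` {b}) (cycle_sets E)"
    and "(b, a) \<in> E\<^sup>* \<Longrightarrow> E\<^sup>* `` {b} \<notin> cycle_sets E"
proof -
  let ?E = "insert (a, b) E"
  have T: "(x, y) \<in> ?E\<^sup>+ \<longleftrightarrow> (x, y) \<in> E\<^sup>+ \<or> (x, a) \<in> E\<^sup>* \<and> (b, y) \<in> E\<^sup>*" for x y
    by (simp add: trancl_insert)
  have R: "(x, y) \<in> ?E\<^sup>* \<longleftrightarrow> (x, y) \<in> E\<^sup>* \<or> (x, a) \<in> E\<^sup>* \<and> (b, y) \<in> E\<^sup>*" for x y
    using T[of x y] by (metis rtrancl.rtrancl_refl rtrancl_eq_or_trancl)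
  \<comment> \<open>A vertex reached from a cycle lies on that cycle and thus has an outgoing arc,
    which \<open>a\<close> lacks. Hence old cycles do not see the new arc.\<close>
  have no: "(x, a) \<notin> E\<^sup>*" if "(x, x) \<in> E\<^sup>+" for x
    using cyclic_reach[OF assms(1) that, of a] assms(2) by (metis DomainI tranclD)
  have eq: "?E\<^sup>* `` {x} = E\<^sup>* `` {x}" if "(x, x) \<in> E\<^sup>+" for x
    using no[OF that] by (auto simp: R)
  have old: "cycle_sets E \<subseteq> cycle_sets ?E"
    using eq T unfolding cycle_sets_def by blast
  have new: "(b, a) \<in> E\<^sup>* \<and> ?E\<^sup>* `` {x} = E\<^sup>* `` {b}"
    if x: "(x, x) \<in> ?E\<^sup>+" "(x, x) \<notin> E\<^sup>+" for x
  proof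
    from x have xa: "(x, a) \<in> E\<^sup>*" and bx: "(b, x) \<in> E\<^sup>*" by (auto simp: T)
    then show "(b, a) \<in> E\<^sup>*" by simp
    show "?E\<^sup>* `` {x} = E\<^sup>* `` {b}"
      using xa bx by (auto simp: R intro: rtrancl_trans)
  qed
  show "cycle_sets ?E = cycle_sets E" if "(b, a) \<notin> E\<^sup>*"
  proof
    show "cycle_sets ?E \<subseteq> cycle_sets E"
      using eq new that unfolding cycle_sets_def by blast
  qed (fact old)
  assume ba: "(b, a) \<in> E\<^sup>*"
  show "cycle_sets ?E = insert (E\<^sup>* `` {b}) (cycle_sets E)"
  proof
    show "cycle_sets ?E \<subseteq> insert (E\<^sup>* `` {b}) (cycle_sets E)"
      using eq new unfolding cycle_sets_def by blast
    have "(b, b) \<in> ?E\<^sup>+" using ba by (simp add: T)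
    moreover have "(b, b) \<notin> E\<^sup>+" using no ba by blast
    ultimately have "E\<^sup>* `` {b} \<in> cycle_sets ?E"
      using new unfolding cycle_sets_def by blast
    then show "insert (E\<^sup>* `` {b}) (cycle_sets E) \<subseteq> cycle_sets ?E" using old by blast
  qed
  show "E\<^sup>* `` {b} \<notin> cycle_sets E"
  proof
    assume "E\<^sup>* `` {b} \<in> cycle_sets E"
    then obtain x where "(x, x) \<in> E\<^sup>+" "E\<^sup>* `` {b} = E\<^sup>* `` {x}"
      by (auto simp: cycle_sets_def)
    with ba no show False by blast
  qed
qed

lemma finite_cycle_sets:
  assumes "finite E"
  shows "finite (cycle_sets E)"
proof -
  have "cycle_sets E \<subseteq> (\<lambda>x. E\<^sup>* `` {x}) ` Domain E"
    unfolding cycle_sets_def by (fastforce dest: tranclD)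
  then show ?thesis using assms by (meson finite_Domain finite_imageI finite_subset)
qed

lemma not_reach_fresh:
  assumes "v \<notin> Field E" "x \<noteq> v"
  shows "(v, x) \<notin> E\<^sup>*" "(x, v) \<notin> E\<^sup>*"
  using assms by (metis Field_def DomainI RangeI UnCI converse_rtranclE rtranclE)+

text \<open>Only the loop, and a join of the end of a path to the start of the same path, close a
  cycle.\<close>

lemma card_cycle_sets_extend:
  assumes "finite V" "E \<in> partial_injections V" "v \<notin> V"
  shows "card (cycle_sets (insert (v, v) E)) = Suc (card (cycle_sets E))"
    and "b \<in> V - Range E \<Longrightarrow> card (cycle_sets (insert (v, b) E)) = card (cycle_sets E)"
    and "a \<in> V - Domain E \<Longrightarrow> card (cycle_sets (insert (a, v) E)) = card (cycle_sets E)"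
    and "a \<in> V - Domain E \<Longrightarrow> b \<in> V - Range E \<Longrightarrow>
      card (cycle_sets (insert (v, b) (insert (a, v) E))) =
        (if (b, a) \<in> E\<^sup>* then Suc (card (cycle_sets E)) else card (cycle_sets E))"
proof -
  note E = partial_injectionsD[OF assms(2)]
  have vF: "v \<notin> Field E" and vD: "v \<notin> Domain E" using E(1) assms(3) by (auto simp: Field_def)
  have fin: "finite E" using E(1) assms(1) by (meson finite_SigmaI finite_subset)
  note nr = not_reach_fresh[OF vF]
  show "card (cycle_sets (insert (v, v) E)) = Suc (card (cycle_sets E))"
    using cycle_sets_insert(2,3)[OF E(2) vD, of v] by (simp add: finite_cycle_sets[OF fin])
  show "card (cycle_sets (insert (v, b) E)) = card (cycle_sets E)" if "b \<in> V - Range E"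
    using cycle_sets_insert(1)[OF E(2) vD nr(2)] that assms(3) by (metis DiffD1)
  have av: "cycle_sets (insert (a, v) E) = cycle_sets E" if "a \<in> V - Domain E"
    using cycle_sets_insert(1)[OF E(2) _ nr(1), of a] that assms(3) by (metis DiffD1 DiffD2)
  then show "card (cycle_sets (insert (a, v) E)) = card (cycle_sets E)" if "a \<in> V - Domain E"
    using that by simp
  assume a: "a \<in> V - Domain E" and b: "b \<in> V - Range E"
  let ?E = "insert (a, v) E"
  have sv: "single_valued ?E" using E(2) a by (auto simp: single_valued_def)
  have vD': "v \<notin> Domain ?E" using vD a assms(3) by auto
  \<comment> \<open>Any walk from \<open>b\<close> to \<open>v\<close> ends with the arc
    \<open>(a, v)\<close>, since \<open>E\<close> does not touch \<open>v\<close>.\<close>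
  have reach: "(b, v) \<in> ?E\<^sup>* \<longleftrightarrow> (b, a) \<in> E\<^sup>*"
  proof -
    have "b \<noteq> v" using b assms(3) by auto
    then show ?thesis using nr(2)[of b] by (simp add: rtrancl_eq_or_trancl[of b v ?E] trancl_insert)
      (metis trancl_into_rtrancl)
  qed
  have fin': "finite (cycle_sets ?E)" using fin by (intro finite_cycle_sets) simp
  show "card (cycle_sets (insert (v, b) ?E)) =
        (if (b, a) \<in> E\<^sup>* then Suc (card (cycle_sets E)) else card (cycle_sets E))"
    using cycle_sets_insert[OF sv vD', of b] reach fin' av[OF a] by auto
qed

section \<open>Adding a vertex\<close>

text \<open>The fibre over \<open>E\<close> of the map that deletes \<open>v\<close>.\<close>

definition extensions :: "'a set \<Rightarrow> 'a \<Rightarrow> 'a rel \<Rightarrow> 'a rel set" where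
  "extensions V v E = {E' \<in> partial_injections (insert v V). E' \<inter> V \<times> V = E}"

text \<open>The degree bounds leave \<open>v\<close> at most one successor and one predecessor. A
  successor in \<open>V\<close> must have had no incoming arc, a predecessor in \<open>V\<close> no
  outgoing one; the loop uses up both places.\<close>

lemma extensions_eq:
  assumes "E \<in> partial_injections V" "v \<notin> V"
  shows "extensions V v E = {E, insert (v, v) E}
    \<union> (\<lambda>b. insert (v, b) E) ` (V - Range E)
    \<union> (\<lambda>a. insert (a, v) E) ` (V - Domain E)
    \<union> (\<lambda>(a, b). insert (v, b) (insert (a, v) E)) ` ((V - Domain E) \<times> (V - Range E))"
  (is "_ = ?R")
proof
  note E = partial_injectionsD[OF assms(1)]
  show "?R \<subseteq> extensions V v E"
  proof -
    have sub: "E \<subseteq> insert v V \<times> insert v V" and int: "E \<inter> V \<times> V = E" using E(1) by auto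
    have vE: "v \<notin> Domain E" "v \<notin> Range E" using E(1) assms(2) by auto
    show ?thesis
      using E(2,3) sub int vE assms(2)
      unfolding extensions_def partial_injections_def single_valued_def
      by (auto 0 3)
  qed
  show "extensions V v E \<subseteq> ?R"
  proof
    fix E' assume "E' \<in> extensions V v E"
    then have sub: "E' \<subseteq> insert v V \<times> insert v V" and sv: "single_valued E'" "single_valued (E'\<inverse>)"
      and int: "E' \<inter> V \<times> V = E"
      by (auto simp: extensions_def partial_injections_def)
    note out = single_valuedD[OF sv(1)] and "in" = single_valuedD[OF sv(2), unfolded converse_iff]
    have split: "E' = E \<union> {v} \<times> E' `` {v} \<union> E'\<inverse> `` {v} \<times> {v}"
      using sub int by auto
    consider "E' `` {v} = {}" | b where "E' `` {v} = {b}"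
    proof (cases "E' `` {v} = {}")
      case False
      then obtain b where "(v, b) \<in> E'" by auto
      then have "E' `` {v} = {b}" using out by auto
      then show ?thesis using that by blast
    qed (use that in blast)
    moreover consider "E'\<inverse> `` {v} = {}" | a where "E'\<inverse> `` {v} = {a}"
    proof (cases "E'\<inverse> `` {v} = {}")
      case False
      then obtain a where "(a, v) \<in> E'" by auto
      then have "E'\<inverse> `` {v} = {a}" using "in" by auto
      then show ?thesis using that by blast
    qed (use that in blast)
    ultimately consider
        "E' `` {v} = {}" "E'\<inverse> `` {v} = {}"
      | b where "E' `` {v} = {b}" "E'\<inverse> `` {v} = {}"
      | a where "E' `` {v} = {}" "E'\<inverse> `` {v} = {a}"
      | a b where "E' `` {v} = {b}" "E'\<inverse> `` {v} = {a}"
      by metis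
    then show "E' \<in> ?R"
    proof cases
      case 1
      then show ?thesis using split by simp
    next
      case (2 b)
      then have "(v, b) \<in> E'" "(v, v) \<notin> E'" by auto
      then have "b \<in> V - Range E" using sub int assms(2) "in" by blast
      then show ?thesis using split 2 by auto
    next
      case (3 a)
      then have "(a, v) \<in> E'" "(v, v) \<notin> E'" by auto
      then have "a \<in> V - Domain E" using sub int assms(2) out by blast
      then show ?thesis using split 3 by auto
    next
      case (4 a b)
      then have ab: "(a, v) \<in> E'" "(v, b) \<in> E'" by auto
      show ?thesis
      proof (cases "a = v")
        case True
        then have "b = v" using ab out by blast
        then show ?thesis using True split 4 by auto
      next
        case False
        then have "b \<noteq> v" using ab "in" by blast
        then have "a \<in> V - Domain E" "b \<in> V - Range E"
          using False ab sub int assms(2) "in" out by blast+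
        moreover have "E' = insert (v, b) (insert (a, v) E)" using split 4 by auto
        ultimately show ?thesis by blast
      qed
    qed
  qed
qed

text \<open>The extensions are parametrised injectively by the new neighbours of \<open>v\<close>,
  and the families are pairwise disjoint.\<close>

lemma sum_extensions:
  fixes h :: "'a rel \<Rightarrow> 'b::comm_monoid_add"
  assumes "finite V" "E \<in> partial_injections V" "v \<notin> V"
  shows "sum h (extensions V v E) = h E + h (insert (v, v) E)
    + (\<Sum>b\<in>V - Range E. h (insert (v, b) E))
    + (\<Sum>a\<in>V - Domain E. h (insert (a, v) E))
    + (\<Sum>a\<in>V - Domain E. \<Sum>b\<in>V - Range E. h (insert (v, b) (insert (a, v) E)))"
proof -
  note E = partial_injectionsD(1)[OF assms(2)]
  let ?A = "{E, insert (v, v) E}"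
  let ?B = "(\<lambda>b. insert (v, b) E) ` (V - Range E)"
  let ?C = "(\<lambda>a. insert (a, v) E) ` (V - Domain E)"
  let ?D = "(\<lambda>(a, b). insert (v, b) (insert (a, v) E)) ` ((V - Domain E) \<times> (V - Range E))"
  have vE: "(v, x) \<notin> E" "(x, v) \<notin> E" for x using E assms(3) by auto
  have iB: "inj_on (\<lambda>b. insert (v, b) E) (V - Range E)"
    and iC: "inj_on (\<lambda>a. insert (a, v) E) (V - Domain E)"
    using vE by (auto simp: inj_on_def)
  have iD: "inj_on (\<lambda>(a, b). insert (v, b) (insert (a, v) E)) ((V - Domain E) \<times> (V - Range E))"
  proof (rule inj_onI, clarify)
    fix a b a' b'
    assume *: "insert (v, b) (insert (a, v) E) = insert (v, b') (insert (a', v) E)"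
      and "a \<in> V" "b \<in> V" "a' \<in> V" "b' \<in> V"
    then have "a \<noteq> v" "b \<noteq> v" "a' \<noteq> v" "b' \<noteq> v" using assms(3) by auto
    moreover have "(a, v) \<in> insert (v, b') (insert (a', v) E)"
      "(v, b) \<in> insert (v, b') (insert (a', v) E)" using * by blast+
    ultimately show "a = a' \<and> b = b'" using vE by auto
  qed
  \<comment> \<open>The families are told apart by whether \<open>v\<close> has an arc to
    \<open>V\<close> and whether it has an arc from \<open>V\<close>; the loop counts as
    neither.\<close>
  have out: "(\<exists>x\<in>V. (v, x) \<in> X)" "(\<forall>x\<in>V. (x, v) \<notin> X)" if "X \<in> ?B" for X
    using that vE assms(3) by auto
  have into: "(\<forall>x\<in>V. (v, x) \<notin> X)" "(\<exists>x\<in>V. (x, v) \<in> X)" if "X \<in> ?C" for X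
    using that vE assms(3) by auto
  have both: "(\<exists>x\<in>V. (v, x) \<in> X)" "(\<exists>x\<in>V. (x, v) \<in> X)" if "X \<in> ?D" for X
    using that by auto
  have none: "(\<forall>x\<in>V. (v, x) \<notin> X)" "(\<forall>x\<in>V. (x, v) \<notin> X)" if "X \<in> ?A" for X
    using that vE assms(3) by auto
  have "?A \<inter> ?B = {}" using none out by (meson disjoint_iff)
  moreover have "?A \<inter> ?C = {}" "?B \<inter> ?C = {}" using none out into by (meson disjoint_iff)+
  moreover have "?A \<inter> ?D = {}" "?B \<inter> ?D = {}" "?C \<inter> ?D = {}"
    using none out into both by (meson disjoint_iff)+
  ultimately have dB: "?A \<inter> ?B = {}" and dC: "(?A \<union> ?B) \<inter> ?C = {}"
    and dD: "(?A \<union> ?B \<union> ?C) \<inter> ?D = {}"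
    by (simp_all only: Int_Un_distrib2 Un_empty simp_thms)
  have "E \<noteq> insert (v, v) E" using vE by auto
  then have "sum h ?A = h E + h (insert (v, v) E)" by simp
  moreover have "sum h ?B = (\<Sum>b\<in>V - Range E. h (insert (v, b) E))"
    and "sum h ?C = (\<Sum>a\<in>V - Domain E. h (insert (a, v) E))"
    by (simp_all add: sum.reindex[OF iB] sum.reindex[OF iC])
  moreover have "sum h ?D =
      (\<Sum>a\<in>V - Domain E. \<Sum>b\<in>V - Range E. h (insert (v, b) (insert (a, v) E)))"
    unfolding sum.reindex[OF iD] by (simp add: sum.cartesian_product case_prod_unfold)
  moreover have "finite ?A" "finite ?B" "finite ?C" "finite ?D" using assms(1) by auto
  ultimately show ?thesis
    unfolding extensions_eq[OF assms(2,3)]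
    by (simp only: sum.union_disjoint[OF _ _ dD] sum.union_disjoint[OF _ _ dC]
        sum.union_disjoint[OF _ _ dB] finite_Un simp_thms)
qed

text \<open>The sum is grouped by the restriction to \<open>V\<close>, which is again a partial
  injection.\<close>

lemma sum_partial_injections_insert:
  fixes h :: "'a rel \<Rightarrow> 'b::comm_monoid_add"
  assumes "finite V"
  shows "sum h (partial_injections (insert v V)) =
    (\<Sum>E\<in>partial_injections V. sum h (extensions V v E))"
  unfolding extensions_def
  by (rule sum.group[symmetric])
     (use assms in \<open>auto simp: finite_partial_injections partial_injections_def single_valued_def\<close>)

section \<open>Vertex types\<close>

text \<open>The added vertex \<open>0\<close> lies below all others, so a missing neighbour counts as a smaller one:
  "smaller" is expressed by a vacuously true universal and "larger" by an existential quantifier.\<close>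

definition peaks :: "'a::linorder set \<Rightarrow> 'a rel \<Rightarrow> 'a set" where
  "peaks V E = {i \<in> V. (\<forall>j. (j, i) \<in> E \<longrightarrow> j < i) \<and> (\<forall>j. (i, j) \<in> E \<longrightarrow> j < i)}"

definition valleys :: "'a::linorder set \<Rightarrow> 'a rel \<Rightarrow> 'a set" where
  "valleys V E = {i \<in> V. (\<exists>j>i. (j, i) \<in> E) \<and> (\<exists>j>i. (i, j) \<in> E)}"

definition double_ascents :: "'a::linorder set \<Rightarrow> 'a rel \<Rightarrow> 'a set" where
  "double_ascents V E = {i \<in> V. (\<forall>j. (j, i) \<in> E \<longrightarrow> j < i) \<and> (\<exists>j>i. (i, j) \<in> E)}"

definition double_descents :: "'a::linorder set \<Rightarrow> 'a rel \<Rightarrow> 'a set" where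
  "double_descents V E = {i \<in> V. (\<exists>j>i. (j, i) \<in> E) \<and> (\<forall>j. (i, j) \<in> E \<longrightarrow> j < i)}"

definition fixed_points :: "'a set \<Rightarrow> 'a rel \<Rightarrow> 'a set" where
  "fixed_points V E = {i \<in> V. (i, i) \<in> E}"

lemmas vertex_type_defs = peaks_def valleys_def double_ascents_def double_descents_def fixed_points_def

section \<open>Effect of a new minimum on the vertex types\<close>

context
  fixes V :: "'a::linorder set" and E :: "'a rel" and v :: 'a
  assumes less: "\<And>x. x \<in> V \<Longrightarrow> v < x" and sub: "E \<subseteq> V \<times> V"
begin

text \<open>For a vertex of \<open>V\<close>, having the smaller \<open>v\<close> as a neighbour
  counts the same as having none on that side. So here and in the next four lemmas only the type of
  \<open>v\<close> itself is added.\<close>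

lemma vertex_types_isolated:
  "peaks (insert v V) E = insert v (peaks V E)"
  "valleys (insert v V) E = valleys V E"
  "double_ascents (insert v V) E = double_ascents V E"
  "double_descents (insert v V) E = double_descents V E"
  "fixed_points (insert v V) E = fixed_points V E"
  using less sub by (fastforce simp: vertex_type_defs)+

lemma vertex_types_loop:
  "peaks (insert v V) (insert (v, v) E) = peaks V E"
  "valleys (insert v V) (insert (v, v) E) = valleys V E"
  "double_ascents (insert v V) (insert (v, v) E) = double_ascents V E"
  "double_descents (insert v V) (insert (v, v) E) = double_descents V E"
  "fixed_points (insert v V) (insert (v, v) E) = insert v (fixed_points V E)"
  using less sub by (fastforce simp: vertex_type_defs)+

lemma vertex_types_prepend:
  assumes "b \<in> V - Range E"
  shows "peaks (insert v V) (insert (v, b) E) = peaks V E"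
    "valleys (insert v V) (insert (v, b) E) = valleys V E"
    "double_ascents (insert v V) (insert (v, b) E) = insert v (double_ascents V E)"
    "double_descents (insert v V) (insert (v, b) E) = double_descents V E"
    "fixed_points (insert v V) (insert (v, b) E) = fixed_points V E"
  using less sub assms by (fastforce simp: vertex_type_defs)+

lemma vertex_types_append:
  assumes "a \<in> V - Domain E"
  shows "peaks (insert v V) (insert (a, v) E) = peaks V E"
    "valleys (insert v V) (insert (a, v) E) = valleys V E"
    "double_ascents (insert v V) (insert (a, v) E) = double_ascents V E"
    "double_descents (insert v V) (insert (a, v) E) = insert v (double_descents V E)"
    "fixed_points (insert v V) (insert (a, v) E) = fixed_points V E"
  using less sub assms by (fastforce simp: vertex_type_defs)+

lemma vertex_types_join:
  assumes "a \<in> V - Domain E" "b \<in> V - Range E"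
  shows "peaks (insert v V) (insert (v, b) (insert (a, v) E)) = peaks V E"
    "valleys (insert v V) (insert (v, b) (insert (a, v) E)) = insert v (valleys V E)"
    "double_ascents (insert v V) (insert (v, b) (insert (a, v) E)) = double_ascents V E"
    "double_descents (insert v V) (insert (v, b) (insert (a, v) E)) = double_descents V E"
    "fixed_points (insert v V) (insert (v, b) (insert (a, v) E)) = fixed_points V E"
  using less sub assms by (fastforce simp: vertex_type_defs)+

end

section \<open>The weighted sum\<close>

lemma tri_array_eq_0: "n < k \<Longrightarrow> tri_array g b n k = 0"
  by (cases n) auto

text \<open>The recurrence is transposed: after shifting the index in its first and last term, each
  entry of row \<open>n\<close> collects the three values of \<open>f\<close> that it feeds. The
  case \<open>k = 0\<close> keeps \<open>b 0\<close> out.\<close>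

lemma sum_tri_array_Suc:
  "(\<Sum>k\<le>Suc n. f k * tri_array g b (Suc n) k) =
    (\<Sum>k\<le>n. (f (Suc k) + g k * f k + (if k = 0 then 0 else b k * f (k - 1))) * tri_array g b n k)"
proof -
  let ?T = "tri_array g b n"
  have "(\<Sum>k\<le>Suc n. f k * tri_array g b (Suc n) k) =
      (\<Sum>k\<le>Suc n. f k * (if k = 0 then 0 else ?T (k - 1))) + (\<Sum>k\<le>Suc n. f k * (g k * ?T k))
      + (\<Sum>k\<le>Suc n. f k * (b (Suc k) * ?T (Suc k)))"
    unfolding sum.distrib[symmetric] by (rule sum.cong) (auto simp: algebra_simps)
  also have "(\<Sum>k\<le>Suc n. f k * (if k = 0 then 0 else ?T (k - 1))) = (\<Sum>k\<le>n. f (Suc k) * ?T k)"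
    by (subst sum.atMost_Suc_shift) simp
  also have "(\<Sum>k\<le>Suc n. f k * (g k * ?T k)) = (\<Sum>k\<le>n. f k * (g k * ?T k))"
    by (simp add: tri_array_eq_0)
  also have "(\<Sum>k\<le>Suc n. f k * (b (Suc k) * ?T (Suc k))) =
      (\<Sum>k\<le>n. (if k = 0 then 0 else f (k - 1) * (b k * ?T k)))"
  \<comment> \<open>Entries with index greater than \<open>n\<close> vanish, so the upper limits can
    be adjusted before and after the index shift.\<close>
  proof -
    have "(\<Sum>k\<le>n. (if k = 0 then 0 else f (k - 1) * (b k * ?T k))) =
        (\<Sum>k\<le>Suc n. (if k = 0 then 0 else f (k - 1) * (b k * ?T k)))"
      by (simp add: tri_array_eq_0)
    also have "\<dots> = (\<Sum>k\<le>n. f k * (b (Suc k) * ?T (Suc k)))"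
      by (subst sum.atMost_Suc_shift) simp
    finally show ?thesis by (simp add: tri_array_eq_0)
  qed
  finally show ?thesis
    unfolding sum.distrib[symmetric] by (auto simp: algebra_simps intro!: sum.cong)
qed

text \<open>An isolated \<open>v\<close> is a new start of a path. A loop or an appended
  \<open>v\<close> leaves the starts alone, a prepended \<open>v\<close> replaces the start
  \<open>b\<close>, and a join removes \<open>b\<close> without making \<open>v\<close> a
  start.\<close>

lemma card_non_range_extend:
  assumes "finite V" "E \<subseteq> V \<times> V" "v \<notin> V"
  shows "card (insert v V - Range E) = Suc (card (V - Range E))"
    and "card (insert v V - Range (insert (v, v) E)) = card (V - Range E)"
    and "b \<in> V - Range E \<Longrightarrow> card (insert v V - Range (insert (v, b) E)) = card (V - Range E)"
    and "card (insert v V - Range (insert (a, v) E)) = card (V - Range E)"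
    and "b \<in> V - Range E \<Longrightarrow>
      card (insert v V - Range (insert (v, b) (insert (a, v) E))) = card (V - Range E) - 1"
proof -
  have v: "v \<notin> Range E" using assms by auto
  have "insert v V - Range E = insert v (V - Range E)" using v by auto
  then show "card (insert v V - Range E) = Suc (card (V - Range E))"
    using assms by simp
  show "card (insert v V - Range (insert (v, v) E)) = card (V - Range E)"
    "card (insert v V - Range (insert (a, v) E)) = card (V - Range E)"
    using assms(3) by (auto intro!: arg_cong[of _ _ card])
  assume b: "b \<in> V - Range E"
  then have "insert v V - Range (insert (v, b) E) = insert v (V - Range E - {b})"
    using v assms(3) by auto
  then show "card (insert v V - Range (insert (v, b) E)) = card (V - Range E)"
    using b assms(1,3) card_Suc_Diff1[of "V - Range E" b] by simp
  have "insert v V - Range (insert (v, b) (insert (a, v) E)) = V - Range E - {b}"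
    using v assms(3) by auto
  then show "card (insert v V - Range (insert (v, b) (insert (a, v) E))) = card (V - Range E) - 1"
    using b by simp
qed

text \<open>Removing the minimum gives an induction: only an isolated \<open>v\<close> adds a path,
  and it adds a peak as well, while no extension destroys a peak. This keeps the subtraction in the
  exponent of \<open>weight\<close> from truncating.\<close>

lemma card_paths_le_card_peaks:
  fixes V :: "'a::linorder set"
  assumes "finite V" "E \<in> partial_injections V"
  shows "card (V - Range E) \<le> card (peaks V E)"
  using assms
proof (induction V arbitrary: E rule: finite_linorder_min_induct)
  case empty
  then show ?case by simp
next
  case (insert v V E')
  have v: "v \<notin> V" using insert.hyps(2) by blast
  define E where "E = E' \<inter> V \<times> V"
  have E: "E \<in> partial_injections V" and ext: "E' \<in> extensions V v E"
    using insert.prems by (auto simp: E_def extensions_def partial_injections_def single_valued_def)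
  note IH = insert.IH[OF E]
  have sub: "E \<subseteq> V \<times> V" by (simp add: E_def)
  have less: "v < x" if "x \<in> V" for x using insert.hyps(2) that by blast
  note types = vertex_types_isolated(1)[OF less sub] vertex_types_loop(1)[OF less sub]
    vertex_types_prepend(1)[OF less sub] vertex_types_append(1)[OF less sub]
    vertex_types_join(1)[OF less sub]
  have peaks: "finite (peaks V E)" "v \<notin> peaks V E"
    using insert.hyps(1) v by (auto simp: peaks_def)
  note simps = types peaks card_non_range_extend[OF insert.hyps(1) sub v]
  consider "E' = E" | "E' = insert (v, v) E" | b where "b \<in> V - Range E" "E' = insert (v, b) E"
    | a where "a \<in> V - Domain E" "E' = insert (a, v) E"
    | a b where "a \<in> V - Domain E" "b \<in> V - Range E" "E' = insert (v, b) (insert (a, v) E)"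
    using ext unfolding extensions_eq[OF E v] by auto
  then show ?case
    by cases (use IH in \<open>simp_all add: simps del: Range_insert\<close>)
qed

text \<open>Each of the \<open>k\<close> starts reaches exactly one of the \<open>k\<close> ends,
  that of its own path. This choice closes a cycle and has weight \<open>c\<close>, the other
  \<open>k - 1\<close> have weight \<open>1\<close>.\<close>

lemma sum_join_weights:
  fixes c :: "'b::comm_ring_1"
  assumes "finite V" "E \<in> partial_injections V"
  defines "k \<equiv> card (V - Range E)"
  shows "(\<Sum>a\<in>V - Domain E. \<Sum>b\<in>V - Range E. if (b, a) \<in> E\<^sup>* then c else 1) =
    of_nat k * (c - 1 + of_nat k)"
proof -
  have inner: "(\<Sum>a\<in>V - Domain E. if (b, a) \<in> E\<^sup>* then c else 1) = c - 1 + of_nat k"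
    if b: "b \<in> V - Range E" for b
  proof -
    obtain a where a: "a \<in> V - Domain E" "(b, a) \<in> E\<^sup>*"
      using end_reachable_exists[OF assms(1,2) b] by blast
    have "(\<Sum>x\<in>V - Domain E. if (b, x) \<in> E\<^sup>* then c else 1) =
        (\<Sum>x\<in>V - Domain E. (if x = a then c - 1 else 0) + 1)"
    proof (rule sum.cong[OF refl])
      fix x assume "x \<in> V - Domain E"
      then have "(b, x) \<in> E\<^sup>* \<longleftrightarrow> x = a"
        using a end_reachable_unique[OF partial_injectionsD(2)[OF assms(2)] a(2)] by blast
      then show "(if (b, x) \<in> E\<^sup>* then c else 1) = (if x = a then c - 1 else 0) + 1" by simp
    qed
    also have "\<dots> = c - 1 + of_nat k"
      using a(1) assms(1) unfolding sum.distrib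
      \<comment> \<open>There are as many ends as starts, both being \<open>card V - card E\<close>
        in number.\<close>
      by (simp add: k_def card_non_domain[OF assms(1,2)] card_non_range[OF assms(1,2)])
    finally show ?thesis .
  qed
  show ?thesis
    by (subst sum.swap) (simp add: inner k_def)
qed

section \<open>Weights on arbitrary finite vertex sets\<close>

context
  fixes u\<^sub>1 u\<^sub>2 u\<^sub>3 u\<^sub>4 \<alpha> \<beta> :: "'a::comm_ring_1"
begin

text \<open>The summand of the theorem, with the number of paths read off from \<open>E\<close>
  instead of being fixed in advance.\<close>

definition weight :: "'b::linorder set \<Rightarrow> 'b rel \<Rightarrow> 'a" where
  "weight V E = u\<^sub>1 ^ (card (peaks V E) - card (V - Range E)) * u\<^sub>2 ^ card (valleys V E)
    * u\<^sub>3 ^ card (double_ascents V E) * u\<^sub>4 ^ card (double_descents V E)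
    * \<alpha> ^ card (fixed_points V E) * \<beta> ^ card (cycle_sets E)"

text \<open>The five kinds of extension give the coefficients: isolated \<open>1\<close>, loop
  \<alpha>\<beta>, prepending \<open>k\<close> times \<open>u\<^sub>3\<close>, appending
  \<open>k\<close> times \<open>u\<^sub>4\<close>, and joining \<open>b_coeff\<close> by
  \<open>sum_join_weights\<close>. The argument of \<open>f\<close> records the new number of
  paths.\<close>

lemma sum_weight_extensions:
  fixes V :: "'b::linorder set"
  assumes "finite V" "E \<in> partial_injections V" and less: "\<And>x. x \<in> V \<Longrightarrow> v < x"
  defines "k \<equiv> card (V - Range E)"
  shows "(\<Sum>E'\<in>extensions V v E. f (card (insert v V - Range E')) * weight (insert v V) E') =
    (f (Suc k) + g_coeff u\<^sub>3 u\<^sub>4 \<alpha> \<beta> k * f k + (if k = 0 then 0 else b_coeff u\<^sub>1 u\<^sub>2 \<beta> k * f (k - 1)))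
      * weight V E"
proof -
  have v: "v \<notin> V" using less by blast
  note sub = partial_injectionsD(1)[OF assms(2)]
  let ?h = "\<lambda>E'. f (card (insert v V - Range E')) * weight (insert v V) E'"
  have fresh: "v \<notin> peaks V E" "v \<notin> valleys V E" "v \<notin> double_ascents V E"
      "v \<notin> double_descents V E" "v \<notin> fixed_points V E"
    and fin: "finite (peaks V E)" "finite (valleys V E)" "finite (double_ascents V E)"
      "finite (double_descents V E)" "finite (fixed_points V E)"
    using v assms(1) by (auto simp: vertex_type_defs)
  note simps = weight_def card_insert_disjoint[OF _ fresh(1)] card_insert_disjoint[OF _ fresh(2)]
    card_insert_disjoint[OF _ fresh(3)] card_insert_disjoint[OF _ fresh(4)]
    card_insert_disjoint[OF _ fresh(5)] fin card_non_range_extend[OF assms(1) sub v]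
    card_cycle_sets_extend[OF assms(1,2) v] k_def[symmetric]
  have isolated: "?h E = f (Suc k) * weight V E"
    by (simp add: simps vertex_types_isolated[OF less sub] del: Range_insert)
  have loop: "?h (insert (v, v) E) = \<alpha> * \<beta> * f k * weight V E"
    by (simp add: simps vertex_types_loop[OF less sub] algebra_simps del: Range_insert)
  have prepend: "?h (insert (v, b) E) = u\<^sub>3 * f k * weight V E" if "b \<in> V - Range E" for b
    using that by (simp add: simps vertex_types_prepend[OF less sub] algebra_simps del: Range_insert)
  have append: "?h (insert (a, v) E) = u\<^sub>4 * f k * weight V E" if "a \<in> V - Domain E" for a
    using that by (simp add: simps vertex_types_append[OF less sub] algebra_simps del: Range_insert)
  have join: "?h (insert (v, b) (insert (a, v) E)) =
      (if (b, a) \<in> E\<^sup>* then \<beta> else 1) * (u\<^sub>1 * u\<^sub>2 * f (k - 1) * weight V E)"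
    if a: "a \<in> V - Domain E" and b: "b \<in> V - Range E" for a b
  proof -
    have "k > 0" using b assms(1) by (auto simp: k_def card_gt_0_iff)
    \<comment> \<open>A join keeps the peaks and lowers the number of paths by one, which is where
      the factor \<open>u\<^sub>1\<close> comes from. Since \<open>0 < k\<close> and
      \<open>k\<close> is at most the number of peaks, no subtraction truncates.\<close>
    then have *: "card (peaks V E) - (k - 1) = Suc (card (peaks V E) - k)"
      using card_paths_le_card_peaks[OF assms(1,2)] by (simp add: k_def)
    show ?thesis
      using a b * by (simp add: simps vertex_types_join[OF less sub] algebra_simps del: One_nat_def Range_insert)
  qed
  have card: "card (V - Domain E) = k"
    by (simp add: k_def card_non_range[OF assms(1,2)] card_non_domain[OF assms(1,2)])
  have "(\<Sum>a\<in>V - Domain E. \<Sum>b\<in>V - Range E. ?h (insert (v, b) (insert (a, v) E))) =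
      (of_nat k * (\<beta> - 1 + of_nat k)) * (u\<^sub>1 * u\<^sub>2 * f (k - 1) * weight V E)"
    unfolding sum_join_weights[OF assms(1,2), folded k_def, symmetric] sum_distrib_right
    by (intro sum.cong refl join)
  moreover have "(\<Sum>b\<in>V - Range E. ?h (insert (v, b) E)) = of_nat k * (u\<^sub>3 * f k * weight V E)"
  proof -
    have "(\<Sum>b\<in>V - Range E. ?h (insert (v, b) E)) = (\<Sum>b\<in>V - Range E. u\<^sub>3 * f k * weight V E)"
      by (rule sum.cong[OF refl]) (rule prepend)
    then show ?thesis by (simp only: sum_constant k_def)
  qed
  moreover have "(\<Sum>a\<in>V - Domain E. ?h (insert (a, v) E)) = of_nat k * (u\<^sub>4 * f k * weight V E)"
  proof -
    have "(\<Sum>a\<in>V - Domain E. ?h (insert (a, v) E)) = (\<Sum>a\<in>V - Domain E. u\<^sub>4 * f k * weight V E)"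
      by (rule sum.cong[OF refl]) (rule append)
    then show ?thesis by (simp only: sum_constant card)
  qed
  ultimately have "sum ?h (extensions V v E) = f (Suc k) * weight V E + \<alpha> * \<beta> * f k * weight V E
      + of_nat k * (u\<^sub>3 * f k * weight V E) + of_nat k * (u\<^sub>4 * f k * weight V E)
      + (of_nat k * (\<beta> - 1 + of_nat k)) * (u\<^sub>1 * u\<^sub>2 * f (k - 1) * weight V E)"
    unfolding sum_extensions[OF assms(1,2) v] isolated loop by (simp only:)
  also have "\<dots> = (f (Suc k) + g_coeff u\<^sub>3 u\<^sub>4 \<alpha> \<beta> k * f k
      + (if k = 0 then 0 else b_coeff u\<^sub>1 u\<^sub>2 \<beta> k * f (k - 1))) * weight V E"
    \<comment> \<open>For \<open>k = 0\<close> the join term vanishes through its factor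
      \<open>of_nat k\<close>, in agreement with the conditional.\<close>
    by (cases k) (simp_all add: g_coeff_def b_coeff_def algebra_simps)
  finally show ?thesis .
qed

text \<open>Testing against an arbitrary function \<open>f\<close> of the number of paths treats all \<open>k\<close> at once and
  turns the recurrence of the array into a substitution for \<open>f\<close> in the induction hypothesis.\<close>

lemma sum_weight_partial_injections:
  fixes V :: "'b::linorder set"
  assumes "finite V"
  shows "(\<Sum>E\<in>partial_injections V. f (card (V - Range E)) * weight V E) =
    (\<Sum>k\<le>card V. f k * \<mu> u\<^sub>1 u\<^sub>2 u\<^sub>3 u\<^sub>4 \<alpha> \<beta> (card V) k)"
  using assms
proof (induction V arbitrary: f rule: finite_linorder_min_induct)
  case empty
  have "partial_injections ({} :: 'b set) = {{}}"
    by (auto simp: partial_injections_def single_valued_def)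
  then show ?case
    by (simp add: weight_def vertex_type_defs cycle_sets_def \<mu>_def)
next
  case (insert v V)
  have less: "v < x" if "x \<in> V" for x using insert.hyps(2) that by blast
  then have v: "v \<notin> V" by blast
  let ?g = "g_coeff u\<^sub>3 u\<^sub>4 \<alpha> \<beta>" and ?b = "b_coeff u\<^sub>1 u\<^sub>2 \<beta>"
  \<comment> \<open>The same expression arises from summing over the extensions and from transposing
    the recurrence.\<close>
  let ?f = "\<lambda>k. f (Suc k) + ?g k * f k + (if k = 0 then 0 else ?b k * f (k - 1))"
  have "(\<Sum>E\<in>partial_injections (insert v V). f (card (insert v V - Range E)) * weight (insert v V) E)
      = (\<Sum>E\<in>partial_injections V. ?f (card (V - Range E)) * weight V E)"
    unfolding sum_partial_injections_insert[OF insert.hyps(1)]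
    by (rule sum.cong[OF refl]) (rule sum_weight_extensions[OF insert.hyps(1) _ less])
  also have "\<dots> = (\<Sum>k\<le>card V. ?f k * tri_array ?g ?b (card V) k)"
    using insert.IH[of ?f] unfolding \<mu>_def .
  also have "\<dots> = (\<Sum>k\<le>card (insert v V). f k * \<mu> u\<^sub>1 u\<^sub>2 u\<^sub>3 u\<^sub>4 \<alpha> \<beta> (card (insert v V)) k)"
    unfolding \<mu>_def card_insert_disjoint[OF insert.hyps(1) v] by (rule sum_tri_array_Suc[symmetric])
  finally show ?case .
qed

end

section \<open>Components of Laguerre digraphs\<close>

text \<open>Walks in the symmetric closure can be reversed, so the two directions in the definition
  of strong components reduce to one.\<close>

lemma in_component_verts_iff:
  "C \<in> component_verts G \<longleftrightarrow> C \<noteq> {} \<and>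
    (\<forall>u\<in>C. \<forall>v. v \<in> C \<longleftrightarrow> (u, v) \<in> rtrancl_on (pverts G) (parcs G \<union> (parcs G)\<inverse>))"
proof -
  have parcs: "parcs (mk_symmetric (with_proj G)) = parcs G \<union> (parcs G)\<inverse>"
    by (auto simp: parcs_mk_symmetric)
  have "(v, u) \<in> rtrancl_on (pverts G) (parcs G \<union> (parcs G)\<inverse>)"
    if "(u, v) \<in> rtrancl_on (pverts G) (parcs G \<union> (parcs G)\<inverse>)" for u v
    using rtrancl_on_converseI[OF that] by (simp add: converse_Un Un_commute)
  then show ?thesis
    unfolding component_verts_def pre_digraph.sccs_verts_def reachable_def
    by (simp add: parcs) blast
qed

lemma component_verts_subset: "C \<in> component_verts G \<Longrightarrow> C \<subseteq> pverts G"
  by (auto simp: in_component_verts_iff dest: in_rtrancl_on_in_F)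

lemma component_verts_disjoint:
  assumes "C \<in> component_verts G" "D \<in> component_verts G" "x \<in> C" "x \<in> D"
  shows "C = D"
  using assms unfolding in_component_verts_iff by blast

lemma component_verts_closed:
  assumes "pair_wf_digraph G" "C \<in> component_verts G" "(x, y) \<in> parcs G"
  shows "x \<in> C \<longleftrightarrow> y \<in> C"
proof -
  have xy: "x \<in> pverts G" "y \<in> pverts G"
    using pair_wf_digraph.wellformed'[OF assms(1,3)] by auto
  then have "(x, y) \<in> rtrancl_on (pverts G) (parcs G \<union> (parcs G)\<inverse>)"
    "(y, x) \<in> rtrancl_on (pverts G) (parcs G \<union> (parcs G)\<inverse>)"
    using assms(3) by (auto intro: rtrancl_on_into_rtrancl_on)
  then show ?thesis using assms(2) unfolding in_component_verts_iff by blast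
qed

text \<open>A reachability set is closed under outgoing arcs, and \<open>closed\<close> adds the
  incoming ones. So no walk in the symmetric closure leaves it, while inside it every vertex is
  connected with \<open>x\<close>.\<close>

lemma reachable_component:
  assumes "pair_wf_digraph G" "x \<in> pverts G"
    and closed: "\<And>y z. (x, y) \<in> (parcs G)\<^sup>* \<Longrightarrow> (z, y) \<in> parcs G \<Longrightarrow> (x, z) \<in> (parcs G)\<^sup>*"
  shows "(parcs G)\<^sup>* `` {x} \<in> component_verts G"
proof -
  let ?R = "rtrancl_on (pverts G) (parcs G \<union> (parcs G)\<inverse>)"
  have into: "(x, y) \<in> ?R" "(y, x) \<in> ?R" if "(x, y) \<in> (parcs G)\<^sup>*" for y
  proof -
    have "(x, y) \<in> rtrancl_on (pverts G) (parcs G)"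
      using that
    proof (induction rule: rtrancl_induct)
      case base
      then show ?case using assms(2) by simp
    next
      case (step y z)
      then show ?case
        using pair_wf_digraph.in_arcsD2[OF assms(1)] by (blast intro: rtrancl_on_into_rtrancl_on)
    qed
    from rtrancl_on_mono[OF _ subset_refl this] rtrancl_on_mono[OF _ subset_refl rtrancl_on_converseI[OF this]]
    show "(x, y) \<in> ?R" "(y, x) \<in> ?R" by blast+
  qed
  moreover have "(x, z) \<in> (parcs G)\<^sup>*" if "(y, z) \<in> ?R" "(x, y) \<in> (parcs G)\<^sup>*" for y z
    using that
  proof (induction rule: rtrancl_on_induct)
    case base
    then show ?case by simp
  next
    case (step y z)
    then show ?case using closed by (auto intro: rtrancl_into_rtrancl)
  qed
  ultimately show ?thesis
    unfolding in_component_verts_iff by (auto intro: rtrancl_on_trans)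
qed

text \<open>Inclusion rather than equality leaves room for a closing arc, so that a chain may
  enumerate a path or a cycle.\<close>

definition chain :: "'a rel \<Rightarrow> 'a list \<Rightarrow> bool" where
  "chain E vs \<longleftrightarrow> vs \<noteq> [] \<and> distinct vs \<and> set (zip vs (tl vs)) \<subseteq> E"

lemma zip_tl_snoc:
  assumes "vs \<noteq> []"
  shows "zip vs (tl vs @ [y]) = zip vs (tl vs) @ [(last vs, y)]"
  using assms
proof (induction vs rule: list_nonempty_induct)
  case (cons w vs)
  then show ?case by (cases vs) auto
qed simp

text \<open>Lets a cycle be treated as a path with a closing arc. For a single vertex there are no
  consecutive pairs, and the closing arc is the loop.\<close>

lemma set_zip_rotate1:
  assumes "vs \<noteq> []"
  shows "set (zip vs (rotate1 vs)) = insert (last vs, hd vs) (set (zip vs (tl vs)))"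
  using assms by (simp add: rotate1_hd_tl zip_tl_snoc)

lemma chain_step:
  assumes "y \<in> set vs" "y \<noteq> last vs"
  shows "\<exists>z. (y, z) \<in> set (zip vs (tl vs))"
  using assms
proof (induction vs)
  case (Cons w vs)
  then show ?case by (cases vs) auto
qed simp

lemma chain_step_back:
  assumes "y \<in> set vs" "y \<noteq> hd vs"
  shows "\<exists>z. (z, y) \<in> set (zip vs (tl vs))"
  using assms
proof (induction vs)
  case (Cons w vs)
  then show ?case by (cases vs) auto
qed simp

lemma zip_tl_not_last: "distinct vs \<Longrightarrow> (y, z) \<in> set (zip vs (tl vs)) \<Longrightarrow> y \<noteq> last vs"
proof (induction vs)
  case (Cons w vs)
  then show ?case by (cases vs) (auto dest: set_zip_leftD)
qed simp

lemma chain_reach: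
  assumes "set (zip vs (tl vs)) \<subseteq> E" "y \<in> set vs"
  shows "(hd vs, y) \<in> E\<^sup>*"
  using assms
proof (induction vs)
  case (Cons w vs)
  then show ?case
    by (cases vs) (auto intro: converse_rtrancl_into_rtrancl)
qed simp

text \<open>A chain from \<open>x\<close> of maximal length can only be continued back to \<open>x\<close>: this enumerates
  paths and cycles alike.\<close>

lemma maximal_chain:
  assumes "finite V" "E \<in> partial_injections V" "x \<in> V"
  obtains vs where "chain E vs" "hd vs = x" "set vs \<subseteq> V"
    "\<forall>y. (last vs, y) \<in> E \<longrightarrow> y = x"
proof -
  note E = partial_injectionsD[OF assms(2)]
  let ?P = "\<lambda>vs. chain E vs \<and> hd vs = x \<and> set vs \<subseteq> V"
  have "?P [x]" using assms(3) by (simp add: chain_def)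
  \<comment> \<open>Chains are distinct lists in \<open>V\<close>, so their lengths are bounded and
    a longest one exists.\<close>
  moreover have "length vs < Suc (card V)" if "?P vs" for vs
    using that assms(1) by (metis card_mono chain_def distinct_card le_imp_less_Suc)
  ultimately have "\<exists>vs. ?P vs \<and> (\<forall>ws. ?P ws \<longrightarrow> length ws \<le> length vs)"
    by (intro ex_has_greatest_nat[of ?P "[x]" length "Suc (card V)"]) blast+
  then obtain vs where vs: "?P vs" and max: "\<And>ws. ?P ws \<Longrightarrow> length ws \<le> length vs"
    by blast
  \<comment> \<open>A listed \<open>y\<close> other than \<open>x\<close> already has a predecessor
    in the chain, which cannot be \<open>last vs\<close>, against injectivity. An unlisted
    \<open>y\<close> would extend the chain.\<close>
  have "y = x" if y: "(last vs, y) \<in> E" for y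
  proof (cases "y \<in> set vs")
    case True
    show ?thesis
    proof (rule ccontr)
      assume "y \<noteq> x"
      then obtain z where z: "(z, y) \<in> set (zip vs (tl vs))"
        using chain_step_back True vs by metis
      then have "(z, y) \<in> E" using vs by (auto simp: chain_def)
      then have "z = last vs" using y E(3) by (metis converse_iff single_valuedD)
      then show False using zip_tl_not_last z vs by (metis chain_def)
    qed
  next
    case False
    have "vs \<noteq> []" using vs by (simp add: chain_def)
    then have "zip (vs @ [y]) (tl (vs @ [y])) = zip vs (tl vs) @ [(last vs, y)]"
      using zip_tl_snoc[of vs y] by (auto simp: neq_Nil_conv zip_append1)
    then have "?P (vs @ [y])"
      using vs False y E(1) \<open>vs \<noteq> []\<close> by (auto simp: chain_def)
    then show ?thesis using max by fastforce
  qed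
  with that vs show ?thesis by blast
qed

text \<open>By single-valuedness every arc that leaves a listed vertex is an arc of the chain or the
  arc \<open>(last vs, x)\<close>, so the list is closed under \<open>E\<close>. The last
  intersection is empty for a path and is the closing arc for a cycle.\<close>

lemma chain_set_eq:
  assumes "single_valued E" "chain E vs" and hd: "hd vs = x" and last: "\<forall>y. (last vs, y) \<in> E \<longrightarrow> y = x"
  shows "set vs = E\<^sup>* `` {x}"
    and "E \<inter> set vs \<times> set vs = set (zip vs (tl vs)) \<union> E \<inter> {(last vs, x)}"
proof -
  have vs: "vs \<noteq> []" "set (zip vs (tl vs)) \<subseteq> E" using assms(2) by (auto simp: chain_def)
  have arc: "(y, z) \<in> set (zip vs (tl vs)) \<or> (y, z) = (last vs, x)"
    if yz: "y \<in> set vs" "(y, z) \<in> E" for y z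
  proof (cases "y = last vs")
    case False
    then obtain z' where "(y, z') \<in> set (zip vs (tl vs))" using chain_step yz(1) by metis
    then show ?thesis using vs(2) yz(2) assms(1) by (metis single_valuedD subsetD)
  qed (use last yz in auto)
  have tl: "set (tl vs) \<subseteq> set vs" by (cases vs) auto
  have "y \<in> set vs" if "(x, y) \<in> E\<^sup>*" for y
    using that
  proof (induction rule: rtrancl_induct)
    case (step y z)
    then have "(y, z) \<in> set (zip vs (tl vs)) \<or> (y, z) = (last vs, x)" using arc by blast
    then show ?case using tl vs(1) hd by (auto dest: set_zip_rightD)
  qed (use vs(1) hd in auto)
  then show "set vs = E\<^sup>* `` {x}" using chain_reach[OF vs(2), unfolded hd] by blast
  show "E \<inter> set vs \<times> set vs = set (zip vs (tl vs)) \<union> E \<inter> {(last vs, x)}"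
    using arc vs tl hd by (auto dest: set_zip_leftD set_zip_rightD)
qed

section \<open>Path and cycle components of a finite partial injection\<close>

context
  fixes G :: "'v pair_pre_digraph"
  assumes fin: "finite (pverts G)" and pinj: "parcs G \<in> partial_injections (pverts G)"
begin

lemma partial_injection_wf: "pair_wf_digraph G"
  using partial_injectionsD(1)[OF pinj] by unfold_locales auto

text \<open>Since \<open>b\<close> has no predecessor, a reached vertex that has one was entered
  from it, and so this unique predecessor is reached as well.\<close>

lemma start_component:
  assumes "b \<in> pverts G - Range (parcs G)"
  shows "(parcs G)\<^sup>* `` {b} \<in> component_verts G"
proof (rule reachable_component[OF partial_injection_wf])
  fix y z assume "(b, y) \<in> (parcs G)\<^sup>*" and zy: "(z, y) \<in> parcs G"
  then obtain w where "(b, w) \<in> (parcs G)\<^sup>*" "(w, y) \<in> parcs G"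
    using assms by (metis DiffD2 Range.intros rtranclE)
  moreover from this zy have "w = z"
    using partial_injectionsD(3)[OF pinj] by (metis converse_iff single_valuedD)
  ultimately show "(b, z) \<in> (parcs G)\<^sup>*" by simp
qed (use assms in simp)

text \<open>Every reached vertex lies on a cycle, so going around reaches its unique predecessor
  too.\<close>

lemma cyclic_component:
  assumes "(x, x) \<in> (parcs G)\<^sup>+"
  shows "(parcs G)\<^sup>* `` {x} \<in> component_verts G"
proof (rule reachable_component[OF partial_injection_wf])
  note E = partial_injectionsD[OF pinj]
  show "x \<in> pverts G" using assms E(1) by (auto dest!: tranclD)
  fix y z assume xy: "(x, y) \<in> (parcs G)\<^sup>*" and zy: "(z, y) \<in> parcs G"
  have "(y, y) \<in> (parcs G)\<^sup>+" using cyclic_reach[OF E(2) assms xy] by blast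
  then obtain w where "(y, w) \<in> (parcs G)\<^sup>*" "(w, y) \<in> parcs G" by (auto dest: tranclD2)
  moreover from this zy have "w = z" using E(3) by (metis converse_iff single_valuedD)
  ultimately show "(x, z) \<in> (parcs G)\<^sup>*" using xy by simp
qed

text \<open>A predecessor of the first entry would lie in the same component and put that entry into
  the tail of a distinct list. Conversely, a maximal chain from a start \<open>b\<close> enumerates
  its component and has no closing arc, as no arc enters \<open>b\<close>.\<close>

lemma path_components_eq:
  "path_components G = (\<lambda>b. (parcs G)\<^sup>* `` {b}) ` (pverts G - Range (parcs G))"
proof (intro equalityI subsetI)
  fix C assume "C \<in> path_components G"
  then obtain vs where C: "C \<in> component_verts G" and vs: "vs \<noteq> []" "distinct vs" "set vs = C"
    and arcs: "parcs G \<inter> C \<times> C = set (zip vs (tl vs))"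
    by (auto simp: path_components_def)
  have hd: "hd vs \<in> C" using vs by auto
  have "hd vs \<notin> Range (parcs G)"
  proof
    assume "hd vs \<in> Range (parcs G)"
    then obtain z where z: "(z, hd vs) \<in> parcs G" by blast
    then have "z \<in> C" using component_verts_closed[OF partial_injection_wf C] hd by blast
    then have "(z, hd vs) \<in> set (zip vs (tl vs))" using z hd arcs by blast
    then have "hd vs \<in> set (tl vs)" by (rule set_zip_rightD)
    then show False using vs by (cases vs) auto
  qed
  then have start: "hd vs \<in> pverts G - Range (parcs G)"
    using hd component_verts_subset[OF C] by blast
  then have "C = (parcs G)\<^sup>* `` {hd vs}"
    using component_verts_disjoint[OF C start_component[OF start] hd] by simp
  then show "C \<in> (\<lambda>b. (parcs G)\<^sup>* `` {b}) ` (pverts G - Range (parcs G))"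
    using start by blast
next
  note E = partial_injectionsD[OF pinj]
  fix C assume "C \<in> (\<lambda>b. (parcs G)\<^sup>* `` {b}) ` (pverts G - Range (parcs G))"
  then obtain b where b: "b \<in> pverts G - Range (parcs G)" and C: "C = (parcs G)\<^sup>* `` {b}"
    by blast
  obtain vs where vs: "chain (parcs G) vs" "hd vs = b" "\<forall>y. (last vs, y) \<in> parcs G \<longrightarrow> y = b"
    using maximal_chain[OF fin pinj] b by blast
  note eq = chain_set_eq[OF E(2) vs]
  have "parcs G \<inter> {(last vs, b)} = {}" using b by blast
  then have "parcs G \<inter> C \<times> C = set (zip vs (tl vs))"
    using eq(2) unfolding C eq(1)[symmetric] by (simp only: Un_empty_right)
  moreover have "set vs = C" using eq(1) C by (simp only:)
  moreover have "vs \<noteq> []" "distinct vs" using vs(1) by (simp_all add: chain_def)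
  moreover have "C \<in> component_verts G" unfolding C by (rule start_component[OF b])
  ultimately show "C \<in> path_components G"
    unfolding path_components_def mem_Collect_eq by (intro conjI exI[of _ vs])
qed

text \<open>A start is reachable only from itself, so distinct starts give distinct
  components.\<close>

lemma card_path_components: "card (path_components G) = card (pverts G - Range (parcs G))"
proof -
  have "inj_on (\<lambda>b. (parcs G)\<^sup>* `` {b}) (pverts G - Range (parcs G))"
  proof (rule inj_onI)
    fix b c
    assume c: "c \<in> pverts G - Range (parcs G)" and "(parcs G)\<^sup>* `` {b} = (parcs G)\<^sup>* `` {c}"
    then have "(b, c) \<in> (parcs G)\<^sup>*" by (metis Image_singleton_iff rtrancl.rtrancl_refl)
    then show "b = c" by (cases rule: rtranclE) (use c in auto)
  qed
  then show ?thesis by (simp add: path_components_eq card_image)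
qed

lemma cycle_components_eq: "cycle_components G = cycle_sets (parcs G)"
proof (intro equalityI subsetI)
  fix C assume "C \<in> cycle_components G"
  then obtain vs where C: "C \<in> component_verts G" and vs: "vs \<noteq> []" "set vs = C"
    and arcs: "parcs G \<inter> C \<times> C = insert (last vs, hd vs) (set (zip vs (tl vs)))"
    by (auto simp: cycle_components_def set_zip_rotate1)
  have "(hd vs, last vs) \<in> (parcs G)\<^sup>*"
    using arcs vs(1) by (intro chain_reach) auto
  moreover have "(last vs, hd vs) \<in> parcs G" using arcs by blast
  ultimately have cyclic: "(hd vs, hd vs) \<in> (parcs G)\<^sup>+" by (rule rtrancl_into_trancl1)
  have "hd vs \<in> C" using vs by auto
  then have "C = (parcs G)\<^sup>* `` {hd vs}"
    using component_verts_disjoint[OF C cyclic_component[OF cyclic]] by simp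
  then show "C \<in> cycle_sets (parcs G)" using cyclic by (auto simp: cycle_sets_def)
next
  note E = partial_injectionsD[OF pinj]
  fix C assume "C \<in> cycle_sets (parcs G)"
  then obtain x where x: "(x, x) \<in> (parcs G)\<^sup>+" and C: "C = (parcs G)\<^sup>* `` {x}"
    by (auto simp: cycle_sets_def)
  have "x \<in> pverts G" using x E(1) by (auto dest!: tranclD)
  then obtain vs where vs: "chain (parcs G) vs" "hd vs = x"
    "\<forall>y. (last vs, y) \<in> parcs G \<longrightarrow> y = x"
    using maximal_chain[OF fin pinj] by blast
  note eq = chain_set_eq[OF E(2) vs]
  have ne: "vs \<noteq> []" using vs(1) by (simp add: chain_def)
  then have "last vs \<in> set vs" by (rule last_in_set)
  then have "(x, last vs) \<in> (parcs G)\<^sup>*" by (simp only: eq(1) Image_singleton_iff)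
  then have "(last vs, last vs) \<in> (parcs G)\<^sup>+" using cyclic_reach[OF E(2) x] by blast
  \<comment> \<open>Being on a cycle, \<open>last vs\<close> has a successor, which the choice of
    the chain forces to be \<open>x\<close>.\<close>
  then have "(last vs, x) \<in> parcs G" using vs(3) by (metis tranclD)
  then have "parcs G \<inter> C \<times> C = set (zip vs (rotate1 vs))" "set vs = C"
    using eq C vs(2) by (auto simp: set_zip_rotate1[OF ne])
  moreover have "vs \<noteq> []" "distinct vs" using vs(1) by (simp_all add: chain_def)
  moreover have "C \<in> component_verts G" unfolding C by (rule cyclic_component[OF x])
  ultimately show "C \<in> cycle_components G"
    unfolding cycle_components_def mem_Collect_eq by (intro conjI exI[of _ vs])
qed

end

lemma laguerre_digraphs_iff:
  "G \<in> laguerre_digraphs n \<longleftrightarrow> pverts G = {1..n} \<and> parcs G \<in> partial_injections {1..n}"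
proof (cases "pverts G = {1..n} \<and> parcs G \<subseteq> {1..n} \<times> {1..n}")
  case True
  \<comment> \<open>Infinite sets have \<open>card\<close> equal to \<open>0\<close>; finiteness
    lets the degree bounds be read as uniqueness of arcs.\<close>
  then have "finite (parcs G)" by (meson finite_SigmaI finite_atLeastAtMost finite_subset)
  then have fin: "finite (in_arcs (with_proj G) i)" "finite (out_arcs (with_proj G) i)" for i
    by (auto simp: in_arcs_def out_arcs_def)
  have wf: "pair_wf_digraph G" using True by unfold_locales auto
  have "in_degree (with_proj G) i \<le> 1 \<longleftrightarrow> (\<forall>j j'. (j, i) \<in> parcs G \<longrightarrow> (j', i) \<in> parcs G \<longrightarrow> j = j')"
    for i
    unfolding in_degree_def One_nat_def card_le_Suc0_iff_eq[OF fin(1)] by (auto simp: in_arcs_def)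
  moreover have "out_degree (with_proj G) i \<le> 1 \<longleftrightarrow>
      (\<forall>j j'. (i, j) \<in> parcs G \<longrightarrow> (i, j') \<in> parcs G \<longrightarrow> j = j')" for i
    unfolding out_degree_def One_nat_def card_le_Suc0_iff_eq[OF fin(2)] by (auto simp: out_arcs_def)
  ultimately have "G \<in> laguerre_digraphs n \<longleftrightarrow> (\<forall>i\<in>{1..n}.
      (\<forall>j j'. (j, i) \<in> parcs G \<longrightarrow> (j', i) \<in> parcs G \<longrightarrow> j = j') \<and>
      (\<forall>j j'. (i, j) \<in> parcs G \<longrightarrow> (i, j') \<in> parcs G \<longrightarrow> j = j'))"
    using True wf by (simp add: laguerre_digraphs_def)
  also have "\<dots> \<longleftrightarrow> single_valued (parcs G) \<and> single_valued ((parcs G)\<inverse>)"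
    using True unfolding single_valued_def converse_iff by blast
  finally show ?thesis using True by (simp add: partial_injections_def)
next
  case False
  then show ?thesis
    by (auto simp: laguerre_digraphs_def partial_injections_def
        dest: pair_wf_digraph.in_arcsD1 pair_wf_digraph.in_arcsD2)
qed

section \<open>Neighbours and vertex statistics in the zero extension\<close>

context
  fixes G :: "nat pair_pre_digraph" and n :: nat
  assumes G: "G \<in> laguerre_digraphs n"
begin

lemma laguerre_partial_injection: "parcs G \<in> partial_injections (pverts G)" and laguerre_finite: "finite (pverts G)"
  using G by (auto simp: laguerre_digraphs_iff)

lemma degree_eq_0_iff:
  "in_degree (with_proj G) i = 0 \<longleftrightarrow> i \<notin> Range (parcs G)"
  "out_degree (with_proj G) i = 0 \<longleftrightarrow> i \<notin> Domain (parcs G)"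
proof -
  have "finite (parcs G)"
    using partial_injectionsD(1)[OF laguerre_partial_injection] laguerre_finite by (meson finite_SigmaI finite_subset)
  then show "in_degree (with_proj G) i = 0 \<longleftrightarrow> i \<notin> Range (parcs G)"
    "out_degree (with_proj G) i = 0 \<longleftrightarrow> i \<notin> Domain (parcs G)"
    by (auto simp: in_degree_def out_degree_def in_arcs_def out_arcs_def card_eq_0_iff)
qed

lemma pre_eq:
  assumes "i \<in> pverts G"
  shows "(j, i) \<in> parcs G \<Longrightarrow> pre G i = j" and "i \<notin> Range (parcs G) \<Longrightarrow> pre G i = 0"
proof -
  \<comment> \<open>Being positive, \<open>i\<close> is not the head of any of the added arcs into
    \<open>0\<close>.\<close>
  have "i > 0" using assms G by (simp add: laguerre_digraphs_iff)
  then have *: "(x, i) \<in> parcs (zero_extension G) \<longleftrightarrow>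
      (x, i) \<in> parcs G \<or> x = 0 \<and> i \<notin> Range (parcs G)" for x
    using assms by (simp add: zero_extension_def degree_eq_0_iff)
  show "pre G i = j" if "(j, i) \<in> parcs G"
    unfolding pre_def * using that partial_injectionsD(3)[OF laguerre_partial_injection]
    by (intro the_equality) (auto dest: single_valuedD)
  show "pre G i = 0" if "i \<notin> Range (parcs G)"
    unfolding pre_def * using that by (intro the_equality) auto
qed

lemma suc_eq:
  assumes "i \<in> pverts G"
  shows "(i, j) \<in> parcs G \<Longrightarrow> suc G i = j" and "i \<notin> Domain (parcs G) \<Longrightarrow> suc G i = 0"
proof -
  have "i > 0" using assms G by (simp add: laguerre_digraphs_iff)
  then have *: "(i, x) \<in> parcs (zero_extension G) \<longleftrightarrow>
      (i, x) \<in> parcs G \<or> x = 0 \<and> i \<notin> Domain (parcs G)" for x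
    using assms by (simp add: zero_extension_def degree_eq_0_iff)
  show "suc G i = j" if "(i, j) \<in> parcs G"
    unfolding suc_def * using that partial_injectionsD(2)[OF laguerre_partial_injection]
    by (intro the_equality) (auto dest: single_valuedD)
  show "suc G i = 0" if "i \<notin> Domain (parcs G)"
    unfolding suc_def * using that by (intro the_equality) auto
qed

text \<open>A missing predecessor gives \<open>pre G i = 0\<close>, which is less than
  \<open>i\<close>; this matches the vacuous truth of the universal statement and the failure of the
  other two.\<close>

lemma pre_iff:
  assumes "i \<in> pverts G"
  shows "pre G i < i \<longleftrightarrow> (\<forall>j. (j, i) \<in> parcs G \<longrightarrow> j < i)"
    and "pre G i > i \<longleftrightarrow> (\<exists>j>i. (j, i) \<in> parcs G)"
    and "pre G i = i \<longleftrightarrow> (i, i) \<in> parcs G"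
proof -
  have i: "i > 0" using assms G by (simp add: laguerre_digraphs_iff)
  have arc: "(j, i) \<in> parcs G \<longleftrightarrow> i \<in> Range (parcs G) \<and> j = pre G i" for j
    using pre_eq[OF assms] by blast
  show "pre G i < i \<longleftrightarrow> (\<forall>j. (j, i) \<in> parcs G \<longrightarrow> j < i)"
    using i pre_eq(2)[OF assms] by (cases "i \<in> Range (parcs G)") (simp_all add: arc)
  show "pre G i > i \<longleftrightarrow> (\<exists>j>i. (j, i) \<in> parcs G)"
    using i pre_eq(2)[OF assms] by (cases "i \<in> Range (parcs G)") (simp_all add: arc)
  show "pre G i = i \<longleftrightarrow> (i, i) \<in> parcs G"
    using i pre_eq(2)[OF assms] by (cases "i \<in> Range (parcs G)") (auto simp: arc)
qed

lemma suc_iff: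
  assumes "i \<in> pverts G"
  shows "suc G i < i \<longleftrightarrow> (\<forall>j. (i, j) \<in> parcs G \<longrightarrow> j < i)"
    and "suc G i > i \<longleftrightarrow> (\<exists>j>i. (i, j) \<in> parcs G)"
    and "i = suc G i \<longleftrightarrow> (i, i) \<in> parcs G"
proof -
  have i: "i > 0" using assms G by (simp add: laguerre_digraphs_iff)
  have arc: "(i, j) \<in> parcs G \<longleftrightarrow> i \<in> Domain (parcs G) \<and> j = suc G i" for j
    using suc_eq[OF assms] by blast
  show "suc G i < i \<longleftrightarrow> (\<forall>j. (i, j) \<in> parcs G \<longrightarrow> j < i)"
    using i suc_eq(2)[OF assms] by (cases "i \<in> Domain (parcs G)") (simp_all add: arc)
  show "suc G i > i \<longleftrightarrow> (\<exists>j>i. (i, j) \<in> parcs G)"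
    using i suc_eq(2)[OF assms] by (cases "i \<in> Domain (parcs G)") (simp_all add: arc)
  show "i = suc G i \<longleftrightarrow> (i, i) \<in> parcs G"
    using i suc_eq(2)[OF assms] by (cases "i \<in> Domain (parcs G)") (auto simp: arc)
qed

lemma laguerre_statistics:
  "pk G = card (peaks (pverts G) (parcs G))"
  "valley G = card (valleys (pverts G) (parcs G))"
  "da G = card (double_ascents (pverts G) (parcs G))"
  "dd G = card (double_descents (pverts G) (parcs G))"
  "fp G = card (fixed_points (pverts G) (parcs G))"
  "cyc G = card (cycle_sets (parcs G))"
  unfolding pk_def valley_def da_def dd_def fp_def cyc_def vertex_type_defs
    cycle_components_eq[OF laguerre_finite laguerre_partial_injection]
  by (simp_all add: pre_iff suc_iff cong: conj_cong)

end

section \<open>Restriction to a fixed number of paths\<close>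

theorem theorem2p3:
  fixes u1 u2 u3 u4 \<alpha> \<beta> :: "'a::comm_ring_1" and n k :: nat
  assumes "k \<le> n"
  shows "\<mu> u1 u2 u3 u4 \<alpha> \<beta> n k =
    (\<Sum>G\<in>LD n k. u1 ^ (pk G - k) * u2 ^ valley G * u3 ^ da G * u4 ^ dd G * \<alpha> ^ fp G * \<beta> ^ cyc G)"
proof -
  let ?V = "{1..n}"
  let ?w = "weight u1 u2 u3 u4 \<alpha> \<beta> ?V"
  let ?S = "{E \<in> partial_injections ?V. card (?V - Range E) = k}"
  have LD: "G \<in> LD n k \<longleftrightarrow> pverts G = ?V \<and> parcs G \<in> ?S" for G
    unfolding LD_def mem_Collect_eq laguerre_digraphs_iff using card_path_components[of G] by auto
  \<comment> \<open>The test function is the indicator of \<open>k\<close>; since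
    \<open>k \<le> n\<close>, it picks out exactly one term of the sum.\<close>
  have "\<mu> u1 u2 u3 u4 \<alpha> \<beta> n k = (\<Sum>j\<le>n. (if j = k then 1 else 0) * \<mu> u1 u2 u3 u4 \<alpha> \<beta> n j)"
    using assms by (simp add: if_distrib[of "\<lambda>x. x * _"] cong: if_cong)
  also have "\<dots> = (\<Sum>E\<in>partial_injections ?V. (if card (?V - Range E) = k then 1 else 0) * ?w E)"
    using sum_weight_partial_injections[of ?V "\<lambda>j. if j = k then 1 else 0" u1 u2 u3 u4 \<alpha> \<beta>] by simp
  also have "\<dots> = (\<Sum>E\<in>?S. ?w E)"
    by (simp add: sum.inter_filter finite_partial_injections if_distrib[of "\<lambda>x. x * _"] cong: if_cong)
  \<comment> \<open>With the vertex set fixed, a digraph is determined by its arcs.\<close>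
  also have "\<dots> = (\<Sum>G\<in>LD n k. ?w (parcs G))"
    by (rule sum.reindex_bij_witness[of _ parcs "\<lambda>E. \<lparr>pverts = ?V, parcs = E\<rparr>"]) (auto simp: LD)
  also have "\<dots> = (\<Sum>G\<in>LD n k.
      u1 ^ (pk G - k) * u2 ^ valley G * u3 ^ da G * u4 ^ dd G * \<alpha> ^ fp G * \<beta> ^ cyc G)"
  proof (rule sum.cong[OF refl])
    fix G assume "G \<in> LD n k"
    then have "G \<in> laguerre_digraphs n" "pverts G = ?V" "card (?V - Range (parcs G)) = k"
      by (simp_all add: LD laguerre_digraphs_iff)
    then show "?w (parcs G) =
        u1 ^ (pk G - k) * u2 ^ valley G * u3 ^ da G * u4 ^ dd G * \<alpha> ^ fp G * \<beta> ^ cyc G"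
      by (simp add: weight_def laguerre_statistics)
  qed
  finally show ?thesis .
qed

end
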